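(* Let $(T,\mathcal{C},\mathcal{I},A)$ be a storyline instance and consider the integer linear program (PLO) described in the context. For every optimal solution of (PLO), defining for each $i$ the linear order $\pi_i$ of $\operatorname{AC}(t_i)$ by $c_u\prec_{\pi_i}c_v$ if and only if $x_{i,u,v}=1$ yields a storyline solution $(\pi_1,\dots,\pi_\ell)$ whose number of crossings is minimum among all storyline solutions of the instance.
   Context: A storyline instance $(T,\mathcal{C},\mathcal{I},A)$ consists of totally ordered time steps $T=\{t_1,\dots,t_\ell\}$, a set of characters $\mathcal{C}=\{c_1,\dots,c_n\}$, a set of interactions $\mathcal{I}$, where each interaction $I$ has a time step $\operatorname{time}(I)\in T$ and a character set $\operatorname{char}(I)\subseteq\mathcal{C}$, and a map $A$ assigning to each character $c$ a set of consecutive time steps (those at which $c$ is active). Let $\operatorname{AC}(t)=\{c: t\in A(c)\}$, $\operatorname{AC}(t_i,t_{j})=\operatorname{AC}(t_i)\cap\dots\cap\operatorname{AC}(t_j)$, $\mathcal{I}(t)=\{I:\operatorname{time}(I)=t\}$, $\operatorname{CI}(t)=\bigcup_{I\in\mathcal{I}(t)}\operatorname{char}(I)$. It is assumed that $\operatorname{char}(I)\subseteq\operatorname{AC}(\operatorname{time}(I))$, that $\mathcal{I}(t)\ne\emptyset$ for every $t$, and that interactions at a common time step have pairwise disjoint character sets. A storyline solution is a sequence $(\pi_1,\dots,\pi_\ell)$, $\pi_i$ a linear order of $\operatorname{AC}(t_i)$ in which each $\operatorname{char}(I)$, $I\in\mathcal{I}(t_i)$, is consecutive; its number of crossings is the sum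 over $i=1,\dots,\ell-1$ of the number of pairs of characters in $\operatorname{AC}(t_i)\cap\operatorname{AC}(t_{i+1})$ whose relative order differs in $\pi_i$ and $\pi_{i+1}$. Below, characters named $c_u,c_v,c_w$ in the same constraint are pairwise distinct. (PLO) has binary variables $x_{i,u,v}$ for $i=1,\dots,\ell$ and $c_u,c_v\in\operatorname{AC}(t_i)$, and binary variables $y_{i,u,v}$ for $i=1,\dots,\ell-1$ and $c_u,c_v\in\operatorname{AC}(t_i,t_{i+1})$. It minimizes $\sum_{i=1}^{\ell-1}\sum_{c_u,c_v\in\operatorname{AC}(t_i,t_{i+1})}y_{i,u,v}$ (sum over ordered pairs) subject to: (EQ) $x_{i,u,v}=1-x_{i,v,u}$ for all $i$ and $c_u,c_v\in\operatorname{AC}(t_i)$; (TREE) $x_{i,u,w}=x_{i,v,w}$ for all $i$, $I\in\mathcal{I}(t_i)$, $c_u,c_v\in\operatorname{char}(I)$, $c_w\in\operatorname{AC}(t_i)\setminus\operatorname{char}(I)$; (CR) $y_{i,u,v}\ge x_{i,u,v}-x_{i+1,u,v}$ for all $i\le\ell-1$ and $c_u,c_v\in\operatorname{AC}(t_i,t_{i+1})$; and transitivity constraints (LOP) $x_{i,u,v}+x_{i,v,w}+x_{i,w,u}\le 2$, included as follows. Call $i\ge 2$ special if $\mathcal{I}(t_i)=\{I\}$ consists of a single interaction and $\operatorname{AC}(t_i)\setminus\operatorname{AC}(t_{i-1})\subseteq\operatorname{CI}(t_i)$. For non-special $i$ (including $i=1$), all (LOP) constraints for triples in $\operatorname{AC}(t_i)$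 are included. For special $i$ with its interaction $I$, fix a representative $c_w\in\operatorname{char}(I)$; among (LOP) constraints at $t_i$ whose triple contains at least one character outside $\operatorname{char}(I)$, only those whose triple consists of exactly two characters $c_u,c_v\in\operatorname{AC}(t_i)\setminus\operatorname{char}(I)$ together with $c_w$ are included, and for all $c_u,c_v\in\operatorname{AC}(t_i)\setminus\operatorname{char}(I)$ the constraints (PROP-R1) $x_{i,u,v}\ge x_{i-1,u,v}+x_{i,u,w}+x_{i,v,w}-2$ and (PROP-R2) $x_{i,u,v}\ge x_{i-1,u,v}+x_{i,w,u}+x_{i,w,v}-2$ are added. Moreover, for special $i$: if $\operatorname{char}(I)\subseteq\operatorname{AC}(t_{i-1})$, no (LOP) constraint with all three characters in $\operatorname{char}(I)$ is included and instead (PROP-I) $x_{i,u,v}=x_{i-1,u,v}$ is added for all $c_u,c_v\in\operatorname{char}(I)$; otherwise all (LOP) constraints with triples in $\operatorname{char}(I)$ are included. *)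

theory Defs
  imports Main
begin

record ('t, 'c, 'i) storyline =
  steps :: "'t set"
  characters :: "'c set"
  interactions :: "'i set"
  int_time :: "'i \<Rightarrow> 't"
  int_char :: "'i \<Rightarrow> 'c set"
  active :: "'c \<Rightarrow> 't set"

definition AC :: "('t, 'c, 'i) storyline \<Rightarrow> 't \<Rightarrow> 'c set" where
  "AC S s = {c \<in> characters S. s \<in> active S c}"

definition interactions_at :: "('t, 'c, 'i) storyline \<Rightarrow> 't \<Rightarrow> 'i set" where
  "interactions_at S s = {I \<in> interactions S. int_time S I = s}"

definition CI :: "('t, 'c, 'i) storyline \<Rightarrow> 't \<Rightarrow> 'c set" where
  "CI S s = (\<Union>I\<in>interactions_at S s. int_char S I)"

definition storyline_instance :: "('t::linorder, 'c, 'i) storyline \<Rightarrow> bool" where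
  "storyline_instance S \<longleftrightarrow>
     finite (steps S) \<and> finite (characters S) \<and> finite (interactions S) \<and>
     (\<forall>c\<in>characters S. active S c \<subseteq> steps S \<and>
        (\<forall>r\<in>active S c. \<forall>s\<in>steps S. \<forall>t\<in>active S c.
           r \<le> s \<and> s \<le> t \<longrightarrow> s \<in> active S c)) \<and>
     (\<forall>I\<in>interactions S. int_time S I \<in> steps S \<and> int_char S I \<subseteq> AC S (int_time S I)) \<and>
     (\<forall>s\<in>steps S. interactions_at S s \<noteq> {}) \<and>
     (\<forall>I\<in>interactions S. \<forall>J\<in>interactions S.
        I \<noteq> J \<and> int_time S I = int_time S J \<longrightarrow> int_char S I \<inter> int_char S J = {})"

definition num_steps :: "('t, 'c, 'i) storyline \<Rightarrow> nat" where
  "num_steps S = card (steps S)"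

text \<open>The time steps in increasing order are \<open>step S 1, \<dots>, step S (num_steps S)\<close>;
  the index starts at 1.\<close>

definition step :: "('t::linorder, 'c, 'i) storyline \<Rightarrow> nat \<Rightarrow> 't" where
  "step S i = sorted_list_of_set (steps S) ! (i - 1)"

definition AC_between :: "('t::linorder, 'c, 'i) storyline \<Rightarrow> nat \<Rightarrow> nat \<Rightarrow> 'c set" where
  "AC_between S i j = (\<Inter>k\<in>{i..j}. AC S (step S k))"

text \<open>A sequence of linear orders is a function on the indices \<open>1, \<dots>, num_steps S\<close> (its values
  elsewhere are irrelevant). Orders are strict: \<open>(u, v) \<in> \<pi> i\<close> means that \<open>u\<close> precedes \<open>v\<close>.\<close>

definition storyline_solution ::
    "('t::linorder, 'c, 'i) storyline \<Rightarrow> (nat \<Rightarrow> 'c rel) \<Rightarrow> bool" where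
  "storyline_solution S \<pi> \<longleftrightarrow>
     (\<forall>i\<in>{1..num_steps S}.
        \<pi> i \<subseteq> AC S (step S i) \<times> AC S (step S i) \<and>
        strict_linear_order_on (AC S (step S i)) (\<pi> i) \<and>
        (\<forall>I\<in>interactions_at S (step S i).
           \<forall>u\<in>int_char S I. \<forall>v\<in>int_char S I. \<forall>w\<in>AC S (step S i).
             (u, w) \<in> \<pi> i \<and> (w, v) \<in> \<pi> i \<longrightarrow> w \<in> int_char S I))"

definition crossings :: "('t::linorder, 'c, 'i) storyline \<Rightarrow> (nat \<Rightarrow> 'c rel) \<Rightarrow> nat" where
  "crossings S \<pi> =
     (\<Sum>i\<in>{1..<num_steps S}.
        card {{u, v} | u v. u \<in> AC S (step S i) \<inter> AC S (step S (i + 1)) \<and>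
                            v \<in> AC S (step S i) \<inter> AC S (step S (i + 1)) \<and> u \<noteq> v \<and>
                            ((u, v) \<in> \<pi> i) \<noteq> ((u, v) \<in> \<pi> (i + 1))})"

definition distinct_pairs :: "'c set \<Rightarrow> ('c \<times> 'c) set" where
  "distinct_pairs X = {(u, v). u \<in> X \<and> v \<in> X \<and> u \<noteq> v}"

definition distinct_triples :: "'c set \<Rightarrow> ('c \<times> 'c \<times> 'c) set" where
  "distinct_triples X =
     {(u, v, w). u \<in> X \<and> v \<in> X \<and> w \<in> X \<and> u \<noteq> v \<and> v \<noteq> w \<and> u \<noteq> w}"

definition special :: "('t::linorder, 'c, 'i) storyline \<Rightarrow> nat \<Rightarrow> bool" where
  "special S i \<longleftrightarrow> 2 \<le> i \<and> i \<le> num_steps S \<and>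
     (\<exists>I. interactions_at S (step S i) = {I}) \<and>
     AC S (step S i) - AC S (step S (i - 1)) \<subseteq> CI S (step S i)"

text \<open>At a special index there is exactly one interaction, so that \<open>CI S (step S i)\<close> below is its
  character set. The representatives are given by \<open>rep\<close>, of which only the values at special
  indices matter.\<close>

definition representatives ::
    "('t::linorder, 'c, 'i) storyline \<Rightarrow> (nat \<Rightarrow> 'c) \<Rightarrow> bool" where
  "representatives S rep \<longleftrightarrow> (\<forall>i. special S i \<longrightarrow> rep i \<in> CI S (step S i))"

text \<open>The ordered triples \<open>(u, v, w)\<close> for which the transitivity constraint
  \<open>x i u v + x i v w + x i w u \<le> 2\<close> is included.\<close>

definition LOP_triples ::
    "('t::linorder, 'c, 'i) storyline \<Rightarrow> (nat \<Rightarrow> 'c) \<Rightarrow> nat \<Rightarrow> ('c \<times> 'c \<times> 'c) set" where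
  "LOP_triples S rep i =
     (if \<not> special S i then distinct_triples (AC S (step S i))
      else {(u, v, w) \<in> distinct_triples (AC S (step S i)).
              \<exists>a\<in>AC S (step S i) - CI S (step S i). \<exists>b\<in>AC S (step S i) - CI S (step S i).
                {u, v, w} = {a, b, rep i}}
           \<union> (if CI S (step S i) \<subseteq> AC S (step S (i - 1)) then {}
              else distinct_triples (CI S (step S i))))"

text \<open>The variables \<open>x i u v\<close> and \<open>y i u v\<close> exist only for \<open>u \<noteq> v\<close> in the index sets
  below; all other values of the functions \<open>x\<close> and \<open>y\<close> are unconstrained and irrelevant.\<close>

definition PLO_binary ::
    "('t::linorder, 'c, 'i) storyline \<Rightarrow> (nat \<Rightarrow> 'c \<Rightarrow> 'c \<Rightarrow> int) \<Rightarrow> (nat \<Rightarrow> 'c \<Rightarrow> 'c \<Rightarrow> int) \<Rightarrow> bool" where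
  "PLO_binary S x y \<longleftrightarrow>
     (\<forall>i\<in>{1..num_steps S}. \<forall>(u, v)\<in>distinct_pairs (AC S (step S i)). x i u v \<in> {0, 1}) \<and>
     (\<forall>i\<in>{1..<num_steps S}. \<forall>(u, v)\<in>distinct_pairs (AC_between S i (i + 1)). y i u v \<in> {0, 1})"

definition PLO_EQ ::
    "('t::linorder, 'c, 'i) storyline \<Rightarrow> (nat \<Rightarrow> 'c \<Rightarrow> 'c \<Rightarrow> int) \<Rightarrow> bool" where
  "PLO_EQ S x \<longleftrightarrow>
     (\<forall>i\<in>{1..num_steps S}. \<forall>(u, v)\<in>distinct_pairs (AC S (step S i)). x i u v = 1 - x i v u)"

definition PLO_TREE ::
    "('t::linorder, 'c, 'i) storyline \<Rightarrow> (nat \<Rightarrow> 'c \<Rightarrow> 'c \<Rightarrow> int) \<Rightarrow> bool" where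
  "PLO_TREE S x \<longleftrightarrow>
     (\<forall>i\<in>{1..num_steps S}. \<forall>I\<in>interactions_at S (step S i).
        \<forall>(u, v)\<in>distinct_pairs (int_char S I). \<forall>w\<in>AC S (step S i) - int_char S I.
          x i u w = x i v w)"

definition PLO_CR ::
    "('t::linorder, 'c, 'i) storyline \<Rightarrow> (nat \<Rightarrow> 'c \<Rightarrow> 'c \<Rightarrow> int) \<Rightarrow> (nat \<Rightarrow> 'c \<Rightarrow> 'c \<Rightarrow> int) \<Rightarrow> bool" where
  "PLO_CR S x y \<longleftrightarrow>
     (\<forall>i\<in>{1..<num_steps S}. \<forall>(u, v)\<in>distinct_pairs (AC_between S i (i + 1)).
        y i u v \<ge> x i u v - x (i + 1) u v)"

definition PLO_LOP ::
    "('t::linorder, 'c, 'i) storyline \<Rightarrow> (nat \<Rightarrow> 'c) \<Rightarrow> (nat \<Rightarrow> 'c \<Rightarrow> 'c \<Rightarrow> int) \<Rightarrow> bool" where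
  "PLO_LOP S rep x \<longleftrightarrow>
     (\<forall>i\<in>{1..num_steps S}. \<forall>(u, v, w)\<in>LOP_triples S rep i.
        x i u v + x i v w + x i w u \<le> 2)"

definition PLO_PROP_R1 ::
    "('t::linorder, 'c, 'i) storyline \<Rightarrow> (nat \<Rightarrow> 'c) \<Rightarrow> (nat \<Rightarrow> 'c \<Rightarrow> 'c \<Rightarrow> int) \<Rightarrow> bool" where
  "PLO_PROP_R1 S rep x \<longleftrightarrow>
     (\<forall>i. special S i \<longrightarrow>
        (\<forall>(u, v)\<in>distinct_pairs (AC S (step S i) - CI S (step S i)).
           x i u v \<ge> x (i - 1) u v + x i u (rep i) + x i v (rep i) - 2))"

definition PLO_PROP_R2 ::
    "('t::linorder, 'c, 'i) storyline \<Rightarrow> (nat \<Rightarrow> 'c) \<Rightarrow> (nat \<Rightarrow> 'c \<Rightarrow> 'c \<Rightarrow> int) \<Rightarrow> bool" where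
  "PLO_PROP_R2 S rep x \<longleftrightarrow>
     (\<forall>i. special S i \<longrightarrow>
        (\<forall>(u, v)\<in>distinct_pairs (AC S (step S i) - CI S (step S i)).
           x i u v \<ge> x (i - 1) u v + x i (rep i) u + x i (rep i) v - 2))"

definition PLO_PROP_I ::
    "('t::linorder, 'c, 'i) storyline \<Rightarrow> (nat \<Rightarrow> 'c \<Rightarrow> 'c \<Rightarrow> int) \<Rightarrow> bool" where
  "PLO_PROP_I S x \<longleftrightarrow>
     (\<forall>i. special S i \<and> CI S (step S i) \<subseteq> AC S (step S (i - 1)) \<longrightarrow>
        (\<forall>(u, v)\<in>distinct_pairs (CI S (step S i)). x i u v = x (i - 1) u v))"

definition PLO_feasible ::
    "('t::linorder, 'c, 'i) storyline \<Rightarrow> (nat \<Rightarrow> 'c) \<Rightarrow> (nat \<Rightarrow> 'c \<Rightarrow> 'c \<Rightarrow> int) \<Rightarrow> (nat \<Rightarrow> 'c \<Rightarrow> 'c \<Rightarrow> int) \<Rightarrow> bool" where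
  "PLO_feasible S rep x y \<longleftrightarrow>
     PLO_binary S x y \<and> PLO_EQ S x \<and> PLO_TREE S x \<and> PLO_CR S x y \<and>
     PLO_LOP S rep x \<and> PLO_PROP_R1 S rep x \<and> PLO_PROP_R2 S rep x \<and> PLO_PROP_I S x"

definition PLO_objective ::
    "('t::linorder, 'c, 'i) storyline \<Rightarrow> (nat \<Rightarrow> 'c \<Rightarrow> 'c \<Rightarrow> int) \<Rightarrow> int" where
  "PLO_objective S y =
     (\<Sum>i\<in>{1..<num_steps S}. \<Sum>(u, v)\<in>distinct_pairs (AC_between S i (i + 1)). y i u v)"

definition PLO_optimal ::
    "('t::linorder, 'c, 'i) storyline \<Rightarrow> (nat \<Rightarrow> 'c) \<Rightarrow>
     (nat \<Rightarrow> 'c \<Rightarrow> 'c \<Rightarrow> int) \<Rightarrow> (nat \<Rightarrow> 'c \<Rightarrow> 'c \<Rightarrow> int) \<Rightarrow> bool" where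
  "PLO_optimal S rep x y \<longleftrightarrow> PLO_feasible S rep x y \<and>
     (\<forall>x' y'. PLO_feasible S rep x' y' \<longrightarrow> PLO_objective S y \<le> PLO_objective S y')"

definition induced_orders ::
    "('t::linorder, 'c, 'i) storyline \<Rightarrow> (nat \<Rightarrow> 'c \<Rightarrow> 'c \<Rightarrow> int) \<Rightarrow> nat \<Rightarrow> 'c rel" where
  "induced_orders S x i = {(u, v) \<in> distinct_pairs (AC S (step S i)). x i u v = 1}"

end

theory Submission
  imports Defs
begin

text \<open>
  Feasible points give storyline solutions because transitivity at a special step follows from
  transitivity at the previous one: two characters outside the interaction lying on the same side
  of the representative are ordered as before, and those on different sides are ordered by the
  remaining transitivity constraints.

  Conversely, a storyline solution is made to satisfy the propagation constraints from left to
  right, by letting the order at a special step copy the previous order on each side of the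
  interaction (and inside it, if all its characters were already active). For every pair of
  characters the new sequence either agrees with the old one or keeps its previous value, and such
  a lazy sequence cannot change more often than the original. Hence the optimum of the program is
  at most the number of crossings of any solution.
\<close>

section \<open>Crossings as ordered inversions\<close>

lemma strict_linear_order_on_not_iff:
  assumes "strict_linear_order_on X r" "u \<in> X" "v \<in> X" "u \<noteq> v"
  shows "(u, v) \<notin> r \<longleftrightarrow> (v, u) \<in> r"
  using assms unfolding strict_linear_order_on_def total_on_def irrefl_def trans_def by blast

text \<open>Crossings are unordered pairs, whereas the objective sums over ordered ones. A pair
  ordered differently by \<open>r\<close> and \<open>s\<close> has exactly one orientation in
  \<open>r - s\<close>, so forgetting the orientation is a bijection.\<close>

lemma card_unordered_inversions:
  assumes r: "strict_linear_order_on X r" and s: "strict_linear_order_on Y s"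
    and Z: "Z \<subseteq> X" "Z \<subseteq> Y"
  shows "card {{u, v} | u v. u \<in> Z \<and> v \<in> Z \<and> u \<noteq> v \<and> ((u, v) \<in> r) \<noteq> ((u, v) \<in> s)} =
    card ((r - s) \<inter> Z \<times> Z)"
proof -
  have not_r: "(u, v) \<notin> r \<longleftrightarrow> (v, u) \<in> r" and not_s: "(u, v) \<notin> s \<longleftrightarrow> (v, u) \<in> s"
    if "u \<in> Z" "v \<in> Z" "u \<noteq> v" for u v
    using that Z strict_linear_order_on_not_iff[OF r] strict_linear_order_on_not_iff[OF s] by blast+
  have irr: "(u, u) \<notin> r" for u
    using r by (auto simp: strict_linear_order_on_def irrefl_def)
  let ?f = "\<lambda>(u, v). {u, v}"
  have inj: "inj_on ?f ((r - s) \<inter> Z \<times> Z)"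
  proof (rule inj_onI)
    fix p q assume p: "p \<in> (r - s) \<inter> Z \<times> Z" and q: "q \<in> (r - s) \<inter> Z \<times> Z"
      and eq: "?f p = ?f q"
    obtain a b c d where pq: "p = (a, b)" "q = (c, d)" by fastforce
    have "a \<noteq> b" using p irr pq by auto
    then have "\<not> (a = d \<and> b = c)" using p q not_r[of a b] unfolding pq by blast
    then show "p = q" using eq unfolding pq by (auto simp: doubleton_eq_iff)
  qed
  have "?f ` ((r - s) \<inter> Z \<times> Z) =
    {{u, v} | u v. u \<in> Z \<and> v \<in> Z \<and> u \<noteq> v \<and> ((u, v) \<in> r) \<noteq> ((u, v) \<in> s)}" (is "_ = ?R")
  proof
    show "?f ` ((r - s) \<inter> Z \<times> Z) \<subseteq> ?R" using irr by fastforce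
    show "?R \<subseteq> ?f ` ((r - s) \<inter> Z \<times> Z)"
    proof
      fix e assume "e \<in> ?R"
      then obtain u v where e: "e = {u, v}" and uv: "u \<in> Z" "v \<in> Z" "u \<noteq> v"
        and "((u, v) \<in> r) \<noteq> ((u, v) \<in> s)" by blast
      then have "(u, v) \<in> r - s \<or> (v, u) \<in> r - s"
        using not_r[of u v] not_s[of u v] not_r[of v u] not_s[of v u] by blast
      then show "e \<in> ?f ` ((r - s) \<inter> Z \<times> Z)"
      proof
        assume "(u, v) \<in> r - s"
        then show ?thesis using uv e by (intro image_eqI[of _ _ "(u, v)"]) auto
      next
        assume "(v, u) \<in> r - s"
        then show ?thesis using uv e by (intro image_eqI[of _ _ "(v, u)"]) auto
      qed
    qed
  qed
  then show ?thesis using card_image[OF inj] by simp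
qed

lemma AC_between_Suc: "AC_between S i (Suc i) = AC S (step S i) \<inter> AC S (step S (Suc i))"
proof -
  have "{i..Suc i} = {i, Suc i}" by auto
  then show ?thesis by (simp add: AC_between_def)
qed

lemma crossings_eq_sum_inversions:
  assumes "storyline_solution S \<pi>"
  shows "crossings S \<pi> = (\<Sum>i\<in>{1..<num_steps S}.
    card ((\<pi> i - \<pi> (Suc i)) \<inter> AC_between S i (Suc i) \<times> AC_between S i (Suc i)))"
  unfolding crossings_def
proof (rule sum.cong[OF refl])
  fix i assume "i \<in> {1..<num_steps S}"
  then have "i \<in> {1..num_steps S}" "Suc i \<in> {1..num_steps S}" by auto
  then have "strict_linear_order_on (AC S (step S i)) (\<pi> i)"
    "strict_linear_order_on (AC S (step S (Suc i))) (\<pi> (Suc i))"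
    using assms unfolding storyline_solution_def by blast+
  from card_unordered_inversions[OF this, of "AC_between S i (Suc i)"]
  show "card {{u, v} | u v. u \<in> AC S (step S i) \<inter> AC S (step S (i + 1)) \<and>
      v \<in> AC S (step S i) \<inter> AC S (step S (i + 1)) \<and> u \<noteq> v \<and>
      ((u, v) \<in> \<pi> i) \<noteq> ((u, v) \<in> \<pi> (i + 1))} =
    card ((\<pi> i - \<pi> (Suc i)) \<inter> AC_between S i (Suc i) \<times> AC_between S i (Suc i))"
    by (simp add: AC_between_Suc)
qed

lemma finite_AC: "storyline_instance S \<Longrightarrow> finite (AC S s)"
  by (auto simp: storyline_instance_def AC_def)

lemma CI_subset_AC: "storyline_instance S \<Longrightarrow> CI S s \<subseteq> AC S s"
  unfolding storyline_instance_def CI_def interactions_at_def by blast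

lemma special_CI:
  assumes "special S i" "I \<in> interactions_at S (step S i)"
  shows "int_char S I = CI S (step S i)"
  using assms by (auto simp: special_def CI_def)

lemma finite_distinct_pairs: "finite X \<Longrightarrow> finite (distinct_pairs X)"
  by (rule finite_subset[of _ "X \<times> X"]) (auto simp: distinct_pairs_def)

section \<open>Feasible points are storyline solutions\<close>

text \<open>\<open>x\<close> is the special step, \<open>p\<close> the step before, \<open>C\<close>
  the interaction and \<open>w\<close> its representative. A violation is a directed 3-cycle,
  excluded by how many of its members lie in \<open>C\<close>. Three: \<open>inside\<close>. Two: by
  \<open>tree\<close> both relate alike to the third. One: by \<open>tree\<close> it may be replaced
  by \<open>w\<close>, against \<open>lop\<close>. None: all three lie on one side of
  \<open>w\<close>, so \<open>p\<close> has the same cycle.\<close>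

lemma transitive_at_special:
  fixes x p :: "'c \<Rightarrow> 'c \<Rightarrow> int"
  assumes CX: "C \<subseteq> X" and wC: "w \<in> C"
    and bin: "\<And>u v. u \<in> X \<Longrightarrow> v \<in> X \<Longrightarrow> u \<noteq> v \<Longrightarrow> x u v = 0 \<or> x u v = 1"
    and eq: "\<And>u v. u \<in> X \<Longrightarrow> v \<in> X \<Longrightarrow> u \<noteq> v \<Longrightarrow> x u v = 1 - x v u"
    and eqp: "\<And>u v. u \<in> X - C \<Longrightarrow> v \<in> X - C \<Longrightarrow> u \<noteq> v \<Longrightarrow> p u v = 1 - p v u"
    and tree: "\<And>u v z. u \<in> C \<Longrightarrow> v \<in> C \<Longrightarrow> u \<noteq> v \<Longrightarrow> z \<in> X - C \<Longrightarrow> x u z = x v z"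
    and lop: "\<And>u v. u \<in> X - C \<Longrightarrow> v \<in> X - C \<Longrightarrow> u \<noteq> v \<Longrightarrow> x u v + x v w + x w u \<le> 2"
    and r1: "\<And>u v. u \<in> X - C \<Longrightarrow> v \<in> X - C \<Longrightarrow> u \<noteq> v \<Longrightarrow> x u v \<ge> p u v + x u w + x v w - 2"
    and r2: "\<And>u v. u \<in> X - C \<Longrightarrow> v \<in> X - C \<Longrightarrow> u \<noteq> v \<Longrightarrow> x u v \<ge> p u v + x w u + x w v - 2"
    and prev: "\<And>a b c. (a, b, c) \<in> distinct_triples (X - C) \<Longrightarrow> p a b + p b c + p c a \<le> 2"
    and inside: "\<And>a b c. (a, b, c) \<in> distinct_triples C \<Longrightarrow> x a b + x b c + x c a \<le> 2"
    and abc: "(a, b, c) \<in> distinct_triples X"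
  shows "x a b + x b c + x c a \<le> 2"
proof (rule ccontr)
  assume gt: "\<not> x a b + x b c + x c a \<le> 2"
  have m: "a \<in> X" "b \<in> X" "c \<in> X" "a \<noteq> b" "b \<noteq> c" "c \<noteq> a"
    using abc by (auto simp: distinct_triples_def)
  have cyc: "x a b = 1" "x b c = 1" "x c a = 1"
    using gt bin[of a b] bin[of b c] bin[of c a] m by auto
  have tree': "x z u = x z v" if "u \<in> C" "v \<in> C" "z \<in> X - C" for u v z
  proof (cases "u = v")
    case False
    have "u \<in> X" "v \<in> X" "z \<in> X" "z \<noteq> u" "z \<noteq> v" using that CX by auto
    then show ?thesis using tree[OF that(1,2) False that(3)] eq[of z u] eq[of z v] by simp
  qed simp
  have tree'': "x u z = x v z" if "u \<in> C" "v \<in> C" "z \<in> X - C" for u v z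
    using tree[of u v z] that by (cases "u = v") auto
  have one: False
    if "u \<in> C" "v \<in> X - C" "z \<in> X - C" "v \<noteq> z" "x u v = 1" "x v z = 1" "x z u = 1" for u v z
    using lop[of v z] tree''[of u w v] tree'[of u w z] that wC by auto
  have two: False
    if "u \<in> C" "v \<in> C" "z \<in> X - C" "x v z = 1" "x z u = 1" for u v z
  proof -
    have "u \<in> X" "z \<in> X" "z \<noteq> u" using that CX by auto
    then show False using tree''[of u v z] eq[of z u] that by auto
  qed
  have none: False if C: "a \<in> X - C" "b \<in> X - C" "c \<in> X - C"
  proof -
    have w: "w \<in> X" "w \<noteq> a" "w \<noteq> b" "w \<noteq> c" using wC CX C by auto
    \<comment> \<open>With \<open>x a b = 1\<close>, \<open>lop\<close> says
      \<open>x b w \<le> x a w\<close>; going round the cycle, the inequalities close up to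
      equalities.\<close>
    have sides: "x a w = x b w" "x b w = x c w"
      using lop[of a b] lop[of b c] lop[of c a] cyc C m
        eq[of w a] eq[of w b] eq[of w c] w bin[of a w] bin[of b w] bin[of c w] by auto
    \<comment> \<open>\<open>r1\<close> (both before \<open>w\<close>) or \<open>r2\<close> (both
      after) gives \<open>x \<ge> p\<close> for \<open>(u, v)\<close> and for \<open>(v, u)\<close>;
      since both matrices are complementary under swapping, equality follows.\<close>
    have keep: "p u v = x u v"
      if "u \<in> X - C" "v \<in> X - C" "u \<noteq> v" "x u w = x v w" for u v
    proof -
      have w': "u \<in> X" "v \<in> X" "w \<in> X" "u \<noteq> w" "v \<noteq> w" using that wC CX by auto
      show ?thesis
        using r1[of u v] r1[of v u] r2[of u v] r2[of v u] bin[of u w] eq[of w u] eq[of w v]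
          eq[of u v] eqp[of u v] that w' by auto
    qed
    have "p a b = 1" "p b c = 1" "p c a = 1"
      using keep[of a b] keep[of b c] keep[of c a] C m cyc sides by auto
    moreover have "(a, b, c) \<in> distinct_triples (X - C)"
      using C m by (auto simp: distinct_triples_def)
    ultimately show False using prev by fastforce
  qed
  have all: "a \<in> C \<Longrightarrow> b \<in> C \<Longrightarrow> c \<in> C \<Longrightarrow> False"
    using inside[of a b c] m cyc by (auto simp: distinct_triples_def)
  show False
    using none all one[of a b c] one[of b c a] one[of c a b] two[of a b c] two[of b c a]
      two[of c a b] m cyc by blast
qed

context
  fixes S :: "('t::linorder, 'c, 'i) storyline" and rep x y
  assumes inst: "storyline_instance S" and rep: "representatives S rep"
    and feas: "PLO_feasible S rep x y"
begin

lemma x_binary: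
  assumes "i \<in> {1..num_steps S}" "u \<in> AC S (step S i)" "v \<in> AC S (step S i)" "u \<noteq> v"
  shows "x i u v = 0 \<or> x i u v = 1"
  using feas assms unfolding PLO_feasible_def PLO_binary_def distinct_pairs_def by fastforce

lemma x_EQ:
  assumes "i \<in> {1..num_steps S}" "u \<in> AC S (step S i)" "v \<in> AC S (step S i)" "u \<noteq> v"
  shows "x i u v = 1 - x i v u"
  using feas assms unfolding PLO_feasible_def PLO_EQ_def distinct_pairs_def by blast

lemma x_TREE:
  assumes "i \<in> {1..num_steps S}" "I \<in> interactions_at S (step S i)"
    "u \<in> int_char S I" "v \<in> int_char S I" "u \<noteq> v" "w \<in> AC S (step S i) - int_char S I"
  shows "x i u w = x i v w"
  using feas assms unfolding PLO_feasible_def PLO_TREE_def distinct_pairs_def by blast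

lemma x_LOP:
  assumes "i \<in> {1..num_steps S}" "(u, v, w) \<in> LOP_triples S rep i"
  shows "x i u v + x i v w + x i w u \<le> 2"
  using feas assms unfolding PLO_feasible_def PLO_LOP_def by blast

text \<open>Induction over time, because a special step inherits transitivity from its predecessor:
  outside the interaction through the propagation constraints, inside it through
  \<open>PLO_PROP_I\<close> unless the constraints for its triples are all present.\<close>

lemma x_transitive:
  assumes "i \<in> {1..num_steps S}" "(a, b, c) \<in> distinct_triples (AC S (step S i))"
  shows "x i a b + x i b c + x i c a \<le> 2"
  using assms
proof (induction i arbitrary: a b c)
  case 0
  then show ?case by simp
next
  case (Suc i)
  let ?X = "AC S (step S (Suc i))" and ?C = "CI S (step S (Suc i))" and ?w = "rep (Suc i)"
  show ?case
  proof (cases "special S (Suc i)")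
    case False
    then show ?thesis using Suc.prems x_LOP by (auto simp: LOP_triples_def)
  next
    case True
    have i: "i \<in> {1..num_steps S}" using True by (auto simp: special_def)
    have CX: "?C \<subseteq> ?X" using CI_subset_AC[OF inst] .
    have wC: "?w \<in> ?C" using rep True by (auto simp: representatives_def)
    \<comment> \<open>All newly active characters belong to the interaction, so for the others the
      variables of step \<open>i\<close> exist and the induction hypothesis applies.\<close>
    have new: "?X - ?C \<subseteq> AC S (step S i)" using True by (auto simp: special_def)
    obtain I where I: "I \<in> interactions_at S (step S (Suc i))"
      using True by (auto simp: special_def)
    note IC = special_CI[OF True I]
    show ?thesis
    proof (rule transitive_at_special[of ?C ?X ?w "x (Suc i)" "x i"])
      fix u v assume uv: "u \<in> ?X - ?C" "v \<in> ?X - ?C" "u \<noteq> v"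
      then have "u \<in> AC S (step S i)" "v \<in> AC S (step S i)" using new by auto
      then show "x i u v = 1 - x i v u" using x_EQ i uv(3) by blast
      have "(u, v, ?w) \<in> LOP_triples S rep (Suc i)"
        using uv wC CX True by (auto simp: LOP_triples_def distinct_triples_def)
      then show "x (Suc i) u v + x (Suc i) v ?w + x (Suc i) ?w u \<le> 2"
        using x_LOP Suc.prems(1) by blast
      have uv': "(u, v) \<in> distinct_pairs (?X - ?C)" using uv by (simp add: distinct_pairs_def)
      show "x (Suc i) u v \<ge> x i u v + x (Suc i) u ?w + x (Suc i) v ?w - 2"
        using feas True uv' unfolding PLO_feasible_def PLO_PROP_R1_def by fastforce
      show "x (Suc i) u v \<ge> x i u v + x (Suc i) ?w u + x (Suc i) ?w v - 2"
        using feas True uv' unfolding PLO_feasible_def PLO_PROP_R2_def by fastforce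
    next
      fix a b c assume "(a, b, c) \<in> distinct_triples (?X - ?C)"
      then have "(a, b, c) \<in> distinct_triples (AC S (step S i))"
        using new by (auto simp: distinct_triples_def)
      then show "x i a b + x i b c + x i c a \<le> 2" by (rule Suc.IH[OF i])
    next
      fix a b c assume abc: "(a, b, c) \<in> distinct_triples ?C"
      show "x (Suc i) a b + x (Suc i) b c + x (Suc i) c a \<le> 2"
      proof (cases "?C \<subseteq> AC S (step S i)")
        case False
        then have "(a, b, c) \<in> LOP_triples S rep (Suc i)"
          using True abc by (simp add: LOP_triples_def)
        then show ?thesis using x_LOP Suc.prems(1) by blast
      next
        case sub: True
        have "x (Suc i) u v = x i u v" if "(u, v) \<in> distinct_pairs ?C" for u v
          using feas True sub that unfolding PLO_feasible_def PLO_PROP_I_def by fastforce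
        moreover have "(a, b) \<in> distinct_pairs ?C" "(b, c) \<in> distinct_pairs ?C"
          "(c, a) \<in> distinct_pairs ?C"
          using abc by (auto simp: distinct_triples_def distinct_pairs_def)
        moreover have "(a, b, c) \<in> distinct_triples (AC S (step S i))"
          using abc sub by (auto simp: distinct_triples_def)
        ultimately show ?thesis using Suc.IH[OF i] by simp
      qed
    next
      fix u v z assume "u \<in> ?C" "v \<in> ?C" "u \<noteq> v" "z \<in> ?X - ?C"
      then show "x (Suc i) u z = x (Suc i) v z"
        by (rule x_TREE[OF Suc.prems(1) I, unfolded IC])
    next
      show "?C \<subseteq> ?X" "?w \<in> ?C" "(a, b, c) \<in> distinct_triples ?X"
        using CX wC Suc.prems(2) by auto
    next
      fix u v assume "u \<in> ?X" "v \<in> ?X" "u \<noteq> v"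
      then show "x (Suc i) u v = 0 \<or> x (Suc i) u v = 1" "x (Suc i) u v = 1 - x (Suc i) v u"
        using x_binary[OF Suc.prems(1)] x_EQ[OF Suc.prems(1)] by blast+
    qed
  qed
qed

text \<open>Consecutiveness comes from \<open>PLO_TREE\<close>: an outsider \<open>w\<close> between
  \<open>u\<close> and \<open>v\<close> would have \<open>x i u w = 1\<close> but
  \<open>x i v w = 0\<close>.\<close>

lemma storyline_solution_induced_orders: "storyline_solution S (induced_orders S x)"
  unfolding storyline_solution_def
proof (intro ballI conjI impI)
  fix i assume i: "i \<in> {1..num_steps S}"
  let ?X = "AC S (step S i)" and ?r = "induced_orders S x i"
  have mem: "(u, v) \<in> ?r \<longleftrightarrow> u \<in> ?X \<and> v \<in> ?X \<and> u \<noteq> v \<and> x i u v = 1" for u v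
    by (auto simp: induced_orders_def distinct_pairs_def)
  show "?r \<subseteq> ?X \<times> ?X" using mem by auto
  have "trans ?r"
  proof (rule transI)
    fix a b c assume ab: "(a, b) \<in> ?r" and bc: "(b, c) \<in> ?r"
    have "a \<noteq> c" using ab bc x_EQ[OF i, of a b] by (auto simp: mem)
    moreover from this have "x i a b + x i b c + x i c a \<le> 2"
      using ab bc by (intro x_transitive[OF i]) (auto simp: mem distinct_triples_def)
    ultimately show "(a, c) \<in> ?r"
      using ab bc x_EQ[OF i, of a c] x_binary[OF i, of a c] by (auto simp: mem)
  qed
  moreover have "irrefl ?r" by (auto simp: irrefl_def mem)
  moreover have "total_on ?X ?r"
  proof (rule total_onI)
    fix u v assume uv: "u \<in> ?X" "v \<in> ?X" "u \<noteq> v"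
    then show "(u, v) \<in> ?r \<or> (v, u) \<in> ?r"
      using x_EQ[OF i uv] x_binary[OF i uv] by (auto simp: mem)
  qed
  ultimately show "strict_linear_order_on ?X ?r" by (simp add: strict_linear_order_on_def)
  fix I u v w
  assume I: "I \<in> interactions_at S (step S i)" and uv: "u \<in> int_char S I" "v \<in> int_char S I"
    and w: "w \<in> ?X" and r: "(u, w) \<in> ?r \<and> (w, v) \<in> ?r"
  show "w \<in> int_char S I"
  proof (rule ccontr)
    assume "w \<notin> int_char S I"
    then have "x i u w = x i v w" using x_TREE[OF i I uv, of w] w by (cases "u = v") auto
    then show False using r x_EQ[OF i, of w v] by (auto simp: mem)
  qed
qed

text \<open>On each ordered inversion \<open>x\<close> drops from 1 to 0, so \<open>PLO_CR\<close>
  forces \<open>y \<ge> 1\<close>; all other terms are nonnegative. Only an inequality holds for a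
  merely feasible \<open>y\<close>, which may be 1 elsewhere.\<close>

lemma crossings_induced_orders_le_objective:
  "int (crossings S (induced_orders S x)) \<le> PLO_objective S y"
  unfolding crossings_eq_sum_inversions[OF storyline_solution_induced_orders]
    PLO_objective_def of_nat_sum
proof (rule sum_mono)
  fix i assume i: "i \<in> {1..<num_steps S}"
  let ?Z = "AC_between S i (Suc i)" and ?\<pi> = "induced_orders S x"
  let ?D = "(?\<pi> i - ?\<pi> (Suc i)) \<inter> ?Z \<times> ?Z"
  have i': "i \<in> {1..num_steps S}" "Suc i \<in> {1..num_steps S}" using i by auto
  have fin: "finite (distinct_pairs ?Z)"
    using finite_AC[OF inst] by (intro finite_distinct_pairs) (simp add: AC_between_Suc)
  have D: "?D \<subseteq> distinct_pairs ?Z" by (auto simp: induced_orders_def distinct_pairs_def)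
  have y01: "y i u v \<ge> 0" if "(u, v) \<in> distinct_pairs ?Z" for u v
    using feas i that unfolding PLO_feasible_def PLO_binary_def by fastforce
  have y1: "y i u v \<ge> 1" if uv: "(u, v) \<in> ?D" for u v
  proof -
    have Z: "u \<in> AC S (step S i)" "v \<in> AC S (step S i)" "u \<in> AC S (step S (Suc i))"
      "v \<in> AC S (step S (Suc i))" "u \<noteq> v"
      using uv D by (auto simp: AC_between_Suc distinct_pairs_def)
    have "x i u v = 1" "x (Suc i) u v \<noteq> 1"
      using uv Z by (auto simp: induced_orders_def distinct_pairs_def)
    moreover have "x (Suc i) u v = 0 \<or> x (Suc i) u v = 1" using x_binary i'(2) Z by blast
    moreover have "y i u v \<ge> x i u v - x (Suc i) u v"
      using feas i uv D unfolding PLO_feasible_def PLO_CR_def by fastforce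
    ultimately show ?thesis by linarith
  qed
  have "int (card ?D) = (\<Sum>(u, v)\<in>?D. 1)" by simp
  also have "\<dots> \<le> (\<Sum>(u, v)\<in>?D. y i u v)" using y1 by (intro sum_mono) auto
  also have "\<dots> \<le> (\<Sum>(u, v)\<in>distinct_pairs ?Z. y i u v)"
    using y01 by (intro sum_mono2[OF fin D]) auto
  finally show "int (card ?D) \<le> (\<Sum>(u, v)\<in>distinct_pairs (AC_between S i (i + 1)). y i u v)"
    by simp
qed

end

section \<open>Propagating a storyline solution\<close>

definition reorder :: "'c rel \<Rightarrow> 'c rel \<Rightarrow> 'c rel \<Rightarrow> 'c rel" where
  "reorder K p r = (r - K) \<union> (p \<inter> K)"

text \<open>\<open>K\<close> is a partial equivalence relation whose classes are intervals of
  \<open>r\<close>, by \<open>convex\<close>. Sorting every class by \<open>p\<close> in its place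
  leaves the order between classes intact, so the result is again linear.\<close>

lemma strict_linear_order_on_reorder:
  assumes r: "strict_linear_order_on X r" and rX: "r \<subseteq> X \<times> X"
    and p: "strict_linear_order_on Y p" and KX: "K \<subseteq> X \<times> X" and KY: "K \<subseteq> Y \<times> Y"
    and K: "sym K" "trans K"
    and convex: "\<And>u w v. (u, w) \<in> r \<Longrightarrow> (w, v) \<in> r \<Longrightarrow> (u, v) \<in> K \<Longrightarrow> (u, w) \<in> K"
  shows "strict_linear_order_on X (reorder K p r)"
proof -
  have tr: "trans r" "irrefl r" "total_on X r" and tp: "trans p" "irrefl p" "total_on Y p"
    using r p by (auto simp: strict_linear_order_on_def)
  note symK = symD[OF K(1)] and transK = transD[OF K(2)]
  have trans_r: "(u, w) \<in> r" if "(u, v) \<in> r" "(v, w) \<in> r" for u v w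
    using tr(1) that by (rule transD)
  have "trans (reorder K p r)"
  proof (rule transI)
    fix a b c assume ab: "(a, b) \<in> reorder K p r" and bc: "(b, c) \<in> reorder K p r"
    consider (rr) "(a, b) \<in> r - K" "(b, c) \<in> r - K" | (rp) "(a, b) \<in> r - K" "(b, c) \<in> p \<inter> K"
      | (pr) "(a, b) \<in> p \<inter> K" "(b, c) \<in> r - K" | (pp) "(a, b) \<in> p \<inter> K" "(b, c) \<in> p \<inter> K"
      using ab bc unfolding reorder_def by blast
    then show "(a, c) \<in> reorder K p r"
    proof cases
      case rr
      then have "(a, c) \<in> r - K" using trans_r convex by blast
      then show ?thesis by (simp add: reorder_def)
    next
      \<comment> \<open>Here \<open>b\<close> and \<open>c\<close> share a class that does not
        contain \<open>a\<close>. As the class is an interval of \<open>r\<close>, \<open>a\<close>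
        precedes all of it once it precedes \<open>b\<close>; the case \<open>pr\<close> is the
        mirror image.\<close>
      case rp
      have nK: "(a, c) \<notin> K" using rp symK transK by blast
      have "a \<noteq> c" using rp symK by blast
      moreover have "(c, a) \<notin> r" using convex[of c a b] rp nK symK by blast
      moreover have "a \<in> X" "c \<in> X" using rp rX KX by auto
      ultimately have "(a, c) \<in> r" using tr(3) by (auto simp: total_on_def)
      then show ?thesis using nK by (simp add: reorder_def)
    next
      case pr
      have nK: "(a, c) \<notin> K" using pr symK transK by blast
      have "a \<noteq> c" using pr symK by blast
      moreover have "(c, a) \<notin> r"
      proof
        assume "(c, a) \<in> r"
        then have "(b, c) \<in> K" using convex[of b c a] pr symK by blast
        then show False using pr by blast
      qed
      moreover have "a \<in> X" "c \<in> X" using pr rX KX by auto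
      ultimately have "(a, c) \<in> r" using tr(3) by (auto simp: total_on_def)
      then show ?thesis using nK by (simp add: reorder_def)
    next
      case pp
      then have "(a, c) \<in> p \<inter> K" using transD[OF tp(1)] transK by blast
      then show ?thesis by (simp add: reorder_def)
    qed
  qed
  moreover have "irrefl (reorder K p r)"
    using tr(2) tp(2) by (auto simp: reorder_def irrefl_def)
  moreover have "total_on X (reorder K p r)"
  proof (rule total_onI)
    fix u v assume uv: "u \<in> X" "v \<in> X" "u \<noteq> v"
    show "(u, v) \<in> reorder K p r \<or> (v, u) \<in> reorder K p r"
    proof (cases "(u, v) \<in> K")
      case True
      then have "(v, u) \<in> K" "u \<in> Y" "v \<in> Y" using symK KY by auto
      then show ?thesis using True tp(3) uv by (auto simp: reorder_def total_on_def)
    next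
      case False
      then have "(v, u) \<notin> K" using symK by blast
      then show ?thesis using False tr(3) uv by (auto simp: reorder_def total_on_def)
    qed
  qed
  ultimately show ?thesis by (simp add: strict_linear_order_on_def)
qed

text \<open>The pairs whose previous order the propagation constraints enforce at a special step.
  The classes are the characters before the interaction, those after it and, if it was fully active
  before, the interaction itself.\<close>

definition kept_pairs ::
    "('t::linorder, 'c, 'i) storyline \<Rightarrow> (nat \<Rightarrow> 'c) \<Rightarrow> nat \<Rightarrow> 'c rel \<Rightarrow> 'c rel" where
  "kept_pairs S rep i r =
     {(u, v). u \<in> AC S (step S i) - CI S (step S i) \<and> v \<in> AC S (step S i) - CI S (step S i) \<and>
        ((u, rep i) \<in> r \<longleftrightarrow> (v, rep i) \<in> r)} \<union>
     (if CI S (step S i) \<subseteq> AC S (step S (i - 1)) then CI S (step S i) \<times> CI S (step S i) else {})"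

text \<open>The order copied is the previous propagated one, not the previous \<open>\<pi>\<close>,
  hence the recursion. Index 0 is no time step, and its value never reaches later indices because
  index 1 is not special.\<close>

primrec propagate ::
    "('t::linorder, 'c, 'i) storyline \<Rightarrow> (nat \<Rightarrow> 'c) \<Rightarrow> (nat \<Rightarrow> 'c rel) \<Rightarrow> nat \<Rightarrow> 'c rel" where
  "propagate S rep \<pi> 0 = \<pi> 0"
| "propagate S rep \<pi> (Suc i) =
     (if special S (Suc i)
      then reorder (kept_pairs S rep (Suc i) (\<pi> (Suc i))) (propagate S rep \<pi> i) (\<pi> (Suc i))
      else \<pi> (Suc i))"

lemma trans_kept_pairs: "trans (kept_pairs S rep i r)"
  unfolding trans_def kept_pairs_def by auto

lemma sym_kept_pairs: "sym (kept_pairs S rep i r)"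
  unfolding sym_def kept_pairs_def by auto

lemma kept_pairs_subset_AC:
  assumes "storyline_instance S"
  shows "kept_pairs S rep i r \<subseteq> AC S (step S i) \<times> AC S (step S i)"
  using CI_subset_AC[OF assms, of "step S i"] by (auto simp: kept_pairs_def split: if_splits)

text \<open>Ensures that there is a previous order to copy: outsiders were active before by the
  definition of \<open>special\<close>, interaction members by the condition in
  \<open>kept_pairs\<close>.\<close>

lemma kept_pairs_subset_prev:
  assumes "special S i"
  shows "kept_pairs S rep i r \<subseteq> AC S (step S (i - 1)) \<times> AC S (step S (i - 1))"
  using assms by (auto simp: kept_pairs_def special_def split: if_splits)

context
  fixes S :: "('t::linorder, 'c, 'i) storyline" and rep \<pi>
  assumes inst: "storyline_instance S" and rep: "representatives S rep"
    and sol: "storyline_solution S \<pi>"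
begin

abbreviation "\<rho> \<equiv> propagate S rep \<pi>"

lemma sol_subset: "i \<in> {1..num_steps S} \<Longrightarrow> \<pi> i \<subseteq> AC S (step S i) \<times> AC S (step S i)"
  using sol unfolding storyline_solution_def by blast

lemma sol_order: "i \<in> {1..num_steps S} \<Longrightarrow> strict_linear_order_on (AC S (step S i)) (\<pi> i)"
  using sol unfolding storyline_solution_def by blast

lemma sol_consecutive:
  assumes "i \<in> {1..num_steps S}" "I \<in> interactions_at S (step S i)"
    "u \<in> int_char S I" "v \<in> int_char S I" "(u, w) \<in> \<pi> i" "(w, v) \<in> \<pi> i"
  shows "w \<in> int_char S I"
  using sol assms sol_subset[OF assms(1)] unfolding storyline_solution_def by blast

text \<open>The classes are intervals because the interaction is consecutive: if \<open>u\<close>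
  and \<open>v\<close> lie on one side of \<open>rep i\<close> and \<open>w\<close> between them
  were in the interaction, then \<open>u\<close> or \<open>v\<close> would be enclosed by
  \<open>w\<close> and \<open>rep i\<close>.\<close>

lemma kept_pairs_convex:
  assumes sp: "special S i" and uw: "(u, w) \<in> \<pi> i" and wv: "(w, v) \<in> \<pi> i"
    and K: "(u, v) \<in> kept_pairs S rep i (\<pi> i)"
  shows "(u, w) \<in> kept_pairs S rep i (\<pi> i)"
proof -
  let ?C = "CI S (step S i)" and ?X = "AC S (step S i)"
  have i: "i \<in> {1..num_steps S}" using sp by (auto simp: special_def)
  obtain I where I: "I \<in> interactions_at S (step S i)" using sp by (auto simp: special_def)
  have conv: "z \<in> ?C" if "a \<in> ?C" "b \<in> ?C" "(a, z) \<in> \<pi> i" "(z, b) \<in> \<pi> i" for a b z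
    using sol_consecutive[OF i I] special_CI[OF sp I] that by blast
  have c: "rep i \<in> ?C" using rep sp by (auto simp: representatives_def)
  have tr: "trans (\<pi> i)" and tot: "total_on ?X (\<pi> i)"
    using sol_order[OF i] by (auto simp: strict_linear_order_on_def)
  have wX: "w \<in> ?X" using sol_subset[OF i] uw by blast
  have cX: "rep i \<in> ?X" using c CI_subset_AC[OF inst] by blast
  show ?thesis
  proof (cases "u \<in> ?C")
    case True
    then have "v \<in> ?C" "?C \<subseteq> AC S (step S (i - 1))"
      using K by (auto simp: kept_pairs_def split: if_splits)
    then show ?thesis using True conv[of u v w] uw wv by (simp add: kept_pairs_def)
  next
    case False
    then have uv: "u \<in> ?X - ?C" "v \<in> ?X - ?C" "(u, rep i) \<in> \<pi> i \<longleftrightarrow> (v, rep i) \<in> \<pi> i"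
      using K by (auto simp: kept_pairs_def split: if_splits)
    have "w \<notin> ?C"
    proof
      assume w: "w \<in> ?C"
      show False
      proof (cases "(u, rep i) \<in> \<pi> i")
        case True
        then show False using conv[OF w c wv] uv by blast
      next
        case False
        then have "(rep i, u) \<in> \<pi> i" using tot uv cX c by (auto simp: total_on_def)
        then show False using conv[OF c w _ uw] uv by blast
      qed
    qed
    moreover have "(u, rep i) \<in> \<pi> i \<longleftrightarrow> (w, rep i) \<in> \<pi> i"
      using uv(3) transD[OF tr uw] transD[OF tr wv] by blast
    ultimately show ?thesis using uv wX by (auto simp: kept_pairs_def)
  qed
qed

lemma propagate_order:
  assumes "i \<in> {1..num_steps S}"
  shows "\<rho> i \<subseteq> AC S (step S i) \<times> AC S (step S i) \<and>
    strict_linear_order_on (AC S (step S i)) (\<rho> i)"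
  using assms
proof (induction i)
  case 0
  then show ?case by simp
next
  case (Suc i)
  let ?X = "AC S (step S (Suc i))" and ?K = "kept_pairs S rep (Suc i) (\<pi> (Suc i))"
  show ?case
  proof (cases "special S (Suc i)")
    case False
    then show ?thesis using sol_subset[OF Suc.prems] sol_order[OF Suc.prems] by simp
  next
    case True
    then have "i \<in> {1..num_steps S}" by (auto simp: special_def)
    then have IH: "strict_linear_order_on (AC S (step S i)) (\<rho> i)" using Suc.IH by blast
    have KX: "?K \<subseteq> ?X \<times> ?X" using kept_pairs_subset_AC[OF inst] .
    have KY: "?K \<subseteq> AC S (step S i) \<times> AC S (step S i)"
      using kept_pairs_subset_prev[OF True] by simp
    have "strict_linear_order_on ?X (reorder ?K (\<rho> i) (\<pi> (Suc i)))"
      by (rule strict_linear_order_on_reorder[OF sol_order[OF Suc.prems] sol_subset[OF Suc.prems]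
            IH KX KY sym_kept_pairs trans_kept_pairs kept_pairs_convex[OF True]])
    moreover have "reorder ?K (\<rho> i) (\<pi> (Suc i)) \<subseteq> ?X \<times> ?X"
      using KX sol_subset[OF Suc.prems] by (auto simp: reorder_def)
    ultimately show ?thesis using True by simp
  qed
qed

lemma propagate_iff_outside:
  assumes "special S i \<Longrightarrow> (u, v) \<notin> kept_pairs S rep i (\<pi> i)"
  shows "(u, v) \<in> \<rho> i \<longleftrightarrow> (u, v) \<in> \<pi> i"
  using assms by (cases i) (auto simp: reorder_def)

lemma propagate_iff_inside:
  assumes "special S i" "(u, v) \<in> kept_pairs S rep i (\<pi> i)"
  shows "(u, v) \<in> \<rho> i \<longleftrightarrow> (u, v) \<in> \<rho> (i - 1)"
  using assms by (cases i) (auto simp: reorder_def special_def)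

text \<open>Kept pairs never combine a member of the interaction with an outsider. Consecutiveness
  and the \<open>PLO_TREE\<close> constraints therefore carry over from
  \<open>\<pi>\<close>.\<close>

lemma propagate_interaction_iff:
  assumes i: "i \<in> {1..num_steps S}" and I: "I \<in> interactions_at S (step S i)"
    and u: "u \<in> int_char S I" and w: "w \<notin> int_char S I"
  shows "(u, w) \<in> \<rho> i \<longleftrightarrow> (u, w) \<in> \<pi> i" "(w, u) \<in> \<rho> i \<longleftrightarrow> (w, u) \<in> \<pi> i"
  using u w special_CI[OF _ I]
  by (intro propagate_iff_outside; auto simp: kept_pairs_def split: if_splits)+

lemma storyline_solution_propagate: "storyline_solution S \<rho>"
  unfolding storyline_solution_def
proof (intro ballI conjI impI)
  fix i assume i: "i \<in> {1..num_steps S}"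
  show "\<rho> i \<subseteq> AC S (step S i) \<times> AC S (step S i)"
    "strict_linear_order_on (AC S (step S i)) (\<rho> i)"
    using propagate_order[OF i] by auto
  fix I u v w
  assume I: "I \<in> interactions_at S (step S i)" "u \<in> int_char S I" "v \<in> int_char S I"
    and r: "(u, w) \<in> \<rho> i \<and> (w, v) \<in> \<rho> i"
  show "w \<in> int_char S I"
    using propagate_interaction_iff[OF i I(1)] sol_consecutive[OF i I] I r by blast
qed

text \<open>The potential \<open>card (\<rho> n - \<pi> n)\<close> counts the pairs on which the lazy sequence currently
  lags behind; each of them has saved a crossing.\<close>

lemma inversions_propagate_le:
  assumes "n \<in> {1..num_steps S}"
  shows "(\<Sum>i\<in>{1..<n}. card ((\<rho> i - \<rho> (Suc i)) \<inter> AC_between S i (Suc i) \<times> AC_between S i (Suc i)))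
      + card (\<rho> n - \<pi> n)
    \<le> (\<Sum>i\<in>{1..<n}. card ((\<pi> i - \<pi> (Suc i)) \<inter> AC_between S i (Suc i) \<times> AC_between S i (Suc i)))"
  using assms
proof (induction n)
  case 0
  then show ?case by simp
next
  case (Suc n)
  show ?case
  proof (cases "n = 0")
    \<comment> \<open>Index 1 is not special, so both sequences agree there and the potential starts
      at 0.\<close>
    case True
    then show ?thesis by (simp add: special_def)
  next
    case False
    then have n: "n \<in> {1..num_steps S}" using Suc.prems by simp
    let ?Z = "AC_between S n (Suc n)"
    let ?A' = "(\<rho> n - \<rho> (Suc n)) \<inter> ?Z \<times> ?Z" and ?D' = "\<rho> (Suc n) - \<pi> (Suc n)"
    let ?A = "(\<pi> n - \<pi> (Suc n)) \<inter> ?Z \<times> ?Z" and ?D = "\<rho> n - \<pi> n"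
    have fin: "finite (\<rho> k)" "finite (\<pi> k)" if "k \<in> {1..num_steps S}" for k
      using propagate_order[OF that] sol_subset[OF that] finite_AC[OF inst]
      by (meson finite_SigmaI finite_subset)+
    \<comment> \<open>A kept pair cannot be in \<open>?A'\<close>, any other pair cannot be in
      \<open>?D'\<close>. Either way the pair is in \<open>\<rho> n\<close> but not in
      \<open>\<pi> (Suc n)\<close>, so it is in \<open>?D\<close> or, if it belongs to
      \<open>\<pi> n\<close>, in \<open>?A\<close>. The latter needs the pair to lie in
      \<open>?Z\<close>, which holds for kept pairs too.\<close>
    have "?A' \<union> ?D' \<subseteq> ?A \<union> ?D"
    proof
      fix e assume e: "e \<in> ?A' \<union> ?D'"
      obtain u v where uv: "e = (u, v)" by fastforce
      show "e \<in> ?A \<union> ?D"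
      proof (cases "special S (Suc n) \<and> (u, v) \<in> kept_pairs S rep (Suc n) (\<pi> (Suc n))")
        case True
        then have "(u, v) \<in> \<rho> (Suc n) \<longleftrightarrow> (u, v) \<in> \<rho> n"
          using propagate_iff_inside[of "Suc n" u v] by (simp del: propagate.simps)
        moreover have "(u, v) \<in> ?Z \<times> ?Z"
          using True kept_pairs_subset_AC[OF inst, of rep "Suc n" "\<pi> (Suc n)"]
            kept_pairs_subset_prev[of S "Suc n" rep "\<pi> (Suc n)"]
          by (auto simp: AC_between_Suc)
        ultimately show ?thesis using e uv by (auto simp del: propagate.simps)
      next
        case False
        then have "(u, v) \<in> \<rho> (Suc n) \<longleftrightarrow> (u, v) \<in> \<pi> (Suc n)"
          using propagate_iff_outside[of "Suc n" u v] by blast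
        then show ?thesis using e uv by (auto simp del: propagate.simps)
      qed
    qed
    moreover have "finite (?A \<union> ?D)" using fin[OF n] by simp
    ultimately have "card (?A' \<union> ?D') \<le> card (?A \<union> ?D)" by (rule card_mono[rotated])
    \<comment> \<open>Disjoint, since \<open>?D'\<close> is contained in
      \<open>\<rho> (Suc n)\<close> and \<open>?A'\<close> avoids it.\<close>
    moreover have "card (?A' \<union> ?D') = card ?A' + card ?D'"
      using fin[OF n] fin[OF Suc.prems]
      by (intro card_Un_disjoint) (auto simp del: propagate.simps)
    moreover have "card (?A \<union> ?D) \<le> card ?A + card ?D" by (rule card_Un_le)
    ultimately have "card ?A' + card ?D' \<le> card ?A + card ?D" by linarith
    moreover have "{1..<Suc n} = insert n {1..<n}" using False by auto
    ultimately show ?thesis using Suc.IH[OF n] by (simp del: propagate.simps)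
  qed
qed

lemma crossings_propagate_le: "crossings S \<rho> \<le> crossings S \<pi>"
proof (cases "num_steps S = 0")
  case True
  then show ?thesis by (simp add: crossings_def)
next
  case False
  then have "num_steps S \<in> {1..num_steps S}" by simp
  from inversions_propagate_le[OF this] show ?thesis
    unfolding crossings_eq_sum_inversions[OF sol]
      crossings_eq_sum_inversions[OF storyline_solution_propagate] by linarith
qed

section \<open>The propagated solution as a feasible point\<close>

definition "x_of i u v = (of_bool ((u, v) \<in> \<rho> i) :: int)"
text \<open>The least binary values that \<open>PLO_CR\<close> permits for
  \<open>x_of\<close>.\<close>

definition "y_of i u v = (of_bool ((u, v) \<in> \<rho> i \<and> (u, v) \<notin> \<rho> (Suc i)) :: int)"

lemma PLO_feasible_propagate: "PLO_feasible S rep x_of y_of"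
proof -
  have ord: "trans (\<rho> i)" "irrefl (\<rho> i)"
    and swap: "u \<in> AC S (step S i) \<Longrightarrow> v \<in> AC S (step S i) \<Longrightarrow> u \<noteq> v \<Longrightarrow>
      (u, v) \<notin> \<rho> i \<longleftrightarrow> (v, u) \<in> \<rho> i"
    if "i \<in> {1..num_steps S}" for i u v
    using propagate_order[OF that]
      strict_linear_order_on_not_iff[OF conjunct2[OF propagate_order[OF that]]]
    by (simp_all add: strict_linear_order_on_def del: propagate.simps)
  have EQ: "PLO_EQ S x_of"
    unfolding PLO_EQ_def
  proof (intro ballI, clarify)
    fix i u v assume "i \<in> {1..num_steps S}" "(u, v) \<in> distinct_pairs (AC S (step S i))"
    then show "x_of i u v = 1 - x_of i v u"
      using swap[of i u v] by (auto simp: x_of_def distinct_pairs_def)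
  qed
  have TREE: "PLO_TREE S x_of"
    unfolding PLO_TREE_def
  proof (intro ballI, clarify)
    fix i I u v w
    assume i: "i \<in> {1..num_steps S}" and I: "I \<in> interactions_at S (step S i)"
      and uv: "(u, v) \<in> distinct_pairs (int_char S I)"
      and w: "w \<in> AC S (step S i)" "w \<notin> int_char S I"
    have sub: "int_char S I \<subseteq> AC S (step S i)"
      using CI_subset_AC[OF inst, of "step S i"] I by (auto simp: CI_def)
    have "(b, w) \<in> \<pi> i" if "(a, w) \<in> \<pi> i" "a \<in> int_char S I" "b \<in> int_char S I" for a b
    proof -
      have "(w, b) \<notin> \<pi> i" using sol_consecutive[OF i I that(2,3,1)] w by blast
      then show ?thesis
        using strict_linear_order_on_not_iff[OF sol_order[OF i], of w b] that sub w by blast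
    qed
    then show "x_of i u w = x_of i v w"
      using uv propagate_interaction_iff(1)[OF i I _ w(2)]
      by (auto simp: x_of_def distinct_pairs_def simp del: propagate.simps)
  qed
  have LOP: "PLO_LOP S rep x_of"
    unfolding PLO_LOP_def
  proof (intro ballI, clarify)
    fix i u v w assume i: "i \<in> {1..num_steps S}"
    have "\<not> ((u, v) \<in> \<rho> i \<and> (v, w) \<in> \<rho> i \<and> (w, u) \<in> \<rho> i)"
      using ord[OF i] unfolding trans_def irrefl_def by blast
    then show "x_of i u v + x_of i v w + x_of i w u \<le> 2" by (auto simp: x_of_def)
  qed
  \<comment> \<open>Sides are measured by \<open>\<rho> i\<close> here but by \<open>\<pi> i\<close>
    in \<open>kept_pairs\<close>; they agree because a pair of an outsider and \<open>rep i\<close>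
    is never kept.\<close>
  have R: "x_of i u v = x_of (i - 1) u v"
    if sp: "special S i" and uv: "(u, v) \<in> distinct_pairs (AC S (step S i) - CI S (step S i))"
      and side: "(u, rep i) \<in> \<rho> i \<longleftrightarrow> (v, rep i) \<in> \<rho> i" for i u v
  proof -
    have c: "rep i \<in> CI S (step S i)" using rep sp by (auto simp: representatives_def)
    have "(a, rep i) \<in> \<rho> i \<longleftrightarrow> (a, rep i) \<in> \<pi> i" if "a \<notin> CI S (step S i)" for a
      using that c by (intro propagate_iff_outside) (auto simp: kept_pairs_def split: if_splits)
    then have "(u, v) \<in> kept_pairs S rep i (\<pi> i)"
      using uv side by (auto simp: kept_pairs_def distinct_pairs_def)
    then show ?thesis using propagate_iff_inside[OF sp] by (simp add: x_of_def)
  qed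
  have R1: "PLO_PROP_R1 S rep x_of"
    unfolding PLO_PROP_R1_def
  proof (intro allI impI ballI, clarify)
    fix i u v
    assume "special S i" "(u, v) \<in> distinct_pairs (AC S (step S i) - CI S (step S i))"
    \<comment> \<open>If \<open>u\<close> and \<open>v\<close> are on different sides of
      \<open>rep i\<close>, the left-hand side is at most 0; otherwise \<open>R\<close>
      applies.\<close>
    from R[OF this]
    show "x_of (i - 1) u v + x_of i u (rep i) + x_of i v (rep i) - 2 \<le> x_of i u v"
      by (auto simp: x_of_def)
  qed
  have R2: "PLO_PROP_R2 S rep x_of"
    unfolding PLO_PROP_R2_def
  proof (intro allI impI ballI, clarify)
    fix i u v
    assume sp: "special S i"
      and uv: "(u, v) \<in> distinct_pairs (AC S (step S i) - CI S (step S i))"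
    have i: "i \<in> {1..num_steps S}" using sp by (auto simp: special_def)
    have c: "rep i \<in> CI S (step S i)" using rep sp by (auto simp: representatives_def)
    \<comment> \<open>Totality translates positions after \<open>rep i\<close> into the form used by
      \<open>R\<close>.\<close>
    then have "(rep i, a) \<in> \<rho> i \<longleftrightarrow> (a, rep i) \<notin> \<rho> i" if "a \<in> {u, v}" for a
      using swap[OF i, of a "rep i"] that uv CI_subset_AC[OF inst, of "step S i"]
      by (auto simp: distinct_pairs_def simp del: propagate.simps)
    with R[OF sp uv]
    show "x_of (i - 1) u v + x_of i (rep i) u + x_of i (rep i) v - 2 \<le> x_of i u v"
      by (auto simp: x_of_def)
  qed
  have "PLO_PROP_I S x_of"
    unfolding PLO_PROP_I_def
  proof (intro allI impI ballI, clarify)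
    fix i u v
    assume sp: "special S i" and sub: "CI S (step S i) \<subseteq> AC S (step S (i - 1))"
      and "(u, v) \<in> distinct_pairs (CI S (step S i))"
    then have "(u, v) \<in> kept_pairs S rep i (\<pi> i)"
      by (auto simp: kept_pairs_def distinct_pairs_def)
    then show "x_of i u v = x_of (i - 1) u v"
      using propagate_iff_inside[OF sp] by (simp add: x_of_def)
  qed
  moreover have "PLO_binary S x_of y_of"
    by (auto simp: PLO_binary_def x_of_def y_of_def)
  moreover have "PLO_CR S x_of y_of"
    by (auto simp: PLO_CR_def x_of_def y_of_def)
  ultimately show ?thesis using EQ TREE LOP R1 R2 by (simp add: PLO_feasible_def)
qed

text \<open>Equality holds because \<open>y_of\<close> is the indicator of the ordered inversions,
  which are pairs of distinct characters by irreflexivity.\<close>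

lemma PLO_objective_propagate: "PLO_objective S y_of = int (crossings S \<rho>)"
  unfolding crossings_eq_sum_inversions[OF storyline_solution_propagate]
    PLO_objective_def of_nat_sum
proof (rule sum.cong[OF refl])
  fix i assume i: "i \<in> {1..<num_steps S}"
  let ?Z = "AC_between S i (Suc i)"
  let ?D = "(\<rho> i - \<rho> (Suc i)) \<inter> ?Z \<times> ?Z"
  have "i \<in> {1..num_steps S}" using i by simp
  then have irr: "irrefl (\<rho> i)"
    using propagate_order by (auto simp: strict_linear_order_on_def)
  have fin: "finite (distinct_pairs ?Z)"
    using finite_AC[OF inst] by (intro finite_distinct_pairs) (simp add: AC_between_Suc)
  have "(\<Sum>(u, v)\<in>distinct_pairs ?Z. y_of i u v) = (\<Sum>e\<in>distinct_pairs ?Z. of_bool (e \<in> ?D))"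
    by (intro sum.cong[OF refl])
      (auto simp: y_of_def distinct_pairs_def simp del: propagate.simps)
  also have "\<dots> = int (card (distinct_pairs ?Z \<inter> ?D))"
    unfolding sum_of_bool_eq[OF fin fin] Collect_mem_eq ..
  also have "distinct_pairs ?Z \<inter> ?D = ?D"
    using irr by (auto simp: distinct_pairs_def irrefl_def simp del: propagate.simps)
  finally show "(\<Sum>(u, v)\<in>distinct_pairs (AC_between S i (i + 1)). y_of i u v) = int (card ?D)"
    by simp
qed

lemma feasible_le_crossings:
  "\<exists>x y. PLO_feasible S rep x y \<and> PLO_objective S y \<le> int (crossings S \<pi>)"
  using PLO_feasible_propagate PLO_objective_propagate crossings_propagate_le
  by (intro exI[of _ x_of] exI[of _ y_of]) simp

end

theorem theorem11:
  fixes S :: "('t::linorder, 'c, 'i) storyline"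
    and rep :: "nat \<Rightarrow> 'c"
    and x y :: "nat \<Rightarrow> 'c \<Rightarrow> 'c \<Rightarrow> int"
  assumes "storyline_instance S"
    and "representatives S rep"
    and "PLO_optimal S rep x y"
  shows "storyline_solution S (induced_orders S x) \<and>
    (\<forall>\<pi>. storyline_solution S \<pi> \<longrightarrow> crossings S (induced_orders S x) \<le> crossings S \<pi>)"
proof (intro conjI allI impI)
  have feas: "PLO_feasible S rep x y" using assms(3) by (simp add: PLO_optimal_def)
  show "storyline_solution S (induced_orders S x)"
    by (rule storyline_solution_induced_orders[OF assms(1,2) feas])
  fix \<pi> assume "storyline_solution S \<pi>"
  then obtain x' y' where "PLO_feasible S rep x' y'" "PLO_objective S y' \<le> int (crossings S \<pi>)"
    using feasible_le_crossings[OF assms(1,2)] by blast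
  \<comment> \<open>The objective of \<open>y\<close> separates the two crossing numbers: it bounds
    that of the induced orders from above and is itself at most that of \<open>\<pi>\<close>, via
    \<open>y'\<close>.\<close>
  moreover from this have "PLO_objective S y \<le> PLO_objective S y'"
    using assms(3) by (auto simp: PLO_optimal_def)
  ultimately show "crossings S (induced_orders S x) \<le> crossings S \<pi>"
    using crossings_induced_orders_le_objective[OF assms(1,2) feas] by linarith
qed

end
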